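(* Let $f$ and $g$ be transcendental entire functions. If $f$ is log-regular and there exist $a_1,a_2\ge1$ and $R_0>0$ such that $$M(r^{a_1},g)\ge M(r,f)\quad\text{and}\quad M(r^{a_2},f)\ge M(r,g)\quad\text{for } r\ge R_0,$$ then $g$ is log-regular.
   Context: For an entire function $f$ put $M(r,f)=\max_{|z|=r}|f(z)|$ for $r>0$. A transcendental entire function $f$ is log-regular (with constant $c>0$) if $\phi(t)=\log M(e^t,f)$ satisfies $\phi'(t)/\phi(t)\ge (1+c)/t$ for all large $t$; it is log-regular if this holds for some $c>0$. (Since $\phi$ is convex, $\phi'$ exists outside a countable set; at exceptional points $\phi'$ is read as the right derivative.) *)

theory Defs
  imports "HOL-Complex_Analysis.Complex_Analysis"
begin

definition transcendental_entire :: "(complex \<Rightarrow> complex) \<Rightarrow> bool" where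
  "transcendental_entire f \<longleftrightarrow>
     f holomorphic_on UNIV \<and> \<not> (\<exists>p. \<forall>z. f z = poly p z)"

(* For continuous f and r >= 0 the circle is compact and nonempty, so the supremum is attained. *)
definition max_modulus :: "real \<Rightarrow> (complex \<Rightarrow> complex) \<Rightarrow> real" where
  "max_modulus r f = (SUP z\<in>sphere 0 r. norm (f z))"

definition log_max_modulus :: "(complex \<Rightarrow> complex) \<Rightarrow> real \<Rightarrow> real" where
  "log_max_modulus f t = ln (max_modulus (exp t) f)"

(* The right derivative D is used at every t; it agrees with the derivative wherever
   the latter exists. It is introduced existentially, so no value is assigned to it by
   default: an inequality can only hold at t if the right derivative exists there. *)
definition log_regular_with :: "real \<Rightarrow> (complex \<Rightarrow> complex) \<Rightarrow> bool" where
  "log_regular_with c f \<longleftrightarrow>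
     (\<forall>\<^sub>F t in at_top. \<exists>D. (log_max_modulus f has_real_derivative D) (at_right t) \<and>
        D / log_max_modulus f t \<ge> (1 + c) / t)"

definition log_regular :: "(complex \<Rightarrow> complex) \<Rightarrow> bool" where
  "log_regular f \<longleftrightarrow> (\<exists>c>0. log_regular_with c f)"

end

theory Submission
  imports Defs
begin

text \<open>
  Write \<open>\<phi>\<close> and \<open>\<psi>\<close> for \<open>log M(e\<^sup>t, \<cdot>)\<close> of \<open>f\<close> and \<open>g\<close>; both are convex by Hadamard's three circles
  theorem. A convex function lies above its one-sided tangents, so log-regularity of \<open>f\<close> gives
  \<open>\<phi>(2t) \<ge> (2 + c) \<phi>(t)\<close>, and iterating, \<open>\<phi>(2\<^sup>nt) \<ge> (2 + c)\<^sup>n \<phi>(t)\<close>. As \<open>((2 + c)/2)\<^sup>n\<close> eventually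
  exceeds the distortion \<open>a\<^sub>1a\<^sub>2\<close> of the comparison between \<open>\<phi>\<close> and \<open>\<psi>\<close>, one gets
  \<open>\<psi>(Kt) \<ge> L \<psi>(t)\<close> with \<open>K = 2\<^sup>na\<^sub>1a\<^sub>2\<close> and \<open>L > K > 1\<close>. The chord of the convex function \<open>\<psi>\<close>
  over \<open>[t/K, t]\<close> then bounds the right derivative at \<open>t\<close> from below.
\<close>

section \<open>One-sided derivatives of convex functions\<close>

lemma convex_on_slope_mono:
  fixes p :: "real \<Rightarrow> real"
  assumes "convex_on UNIV p" "x < y" "y \<le> z"
  shows "(p y - p x) / (y - x) \<le> (p z - p x) / (z - x)"
proof (cases "y = z")
  case False
  then have "(p x - p y) / (x - y) \<le> (p x - p z) / (x - z)"
    using convex_on_slope_le(1)[OF assms(1), of x z y] assms by auto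
  then show ?thesis
    by (metis minus_diff_eq minus_divide_divide)
qed auto

lemma convex_on_slope_left_le_right:
  fixes p :: "real \<Rightarrow> real"
  assumes "convex_on UNIV p" "s < x" "x < y"
  shows "(p x - p s) / (x - s) \<le> (p y - p x) / (y - x)"
proof -
  have "(p s - p x) / (s - x) \<le> (p x - p y) / (x - y)"
    using convex_on_slope_le[OF assms(1), of s y x] assms by fastforce
  then show ?thesis
    by (metis minus_diff_eq minus_divide_divide)
qed

text \<open>As \<open>y\<close> decreases to \<open>x\<close> the difference quotients decrease, and
  a chord slope to the left of \<open>x\<close> bounds them from below, so they converge to their
  infimum.\<close>

lemma convex_on_right_derivative_exists:
  fixes p :: "real \<Rightarrow> real"
  assumes "convex_on UNIV p"
  shows "\<exists>D. (p has_real_derivative D) (at_right x)"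
proof -
  have "((\<lambda>y. (p y - p x) / (y - x)) \<longlongrightarrow>
      Inf ((\<lambda>y. (p y - p x) / (y - x)) ` ({x<..} \<inter> UNIV))) (at x within ({x<..} \<inter> UNIV))"
  proof (rule Lim_right_bound)
    show "(p x - p (x - 1)) / (x - (x - 1)) \<le> (p a - p x) / (a - x)" if "x < a" for a
      using convex_on_slope_left_le_right[OF assms, of "x - 1" x a] that by simp
  qed (use convex_on_slope_mono[OF assms] in auto)
  then show ?thesis
    by (auto simp: has_field_derivative_iff)
qed

text \<open>\<open>D\<close> is at most every chord slope to the right of \<open>x\<close> and at
  least every one to the left. Both sides matter: the tangent is later evaluated ahead of
  \<open>x\<close> for doubling and behind it for the converse.\<close>

lemma convex_on_right_tangent_le:
  fixes p :: "real \<Rightarrow> real"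
  assumes "convex_on UNIV p" and D: "(p has_real_derivative D) (at_right x)"
  shows "p x + D * (y - x) \<le> p y"
proof -
  have lim: "((\<lambda>y. (p y - p x) / (y - x)) \<longlongrightarrow> D) (at_right x)"
    using D by (simp add: has_field_derivative_iff)
  consider "y = x" | "x < y" | "y < x" by linarith
  then show ?thesis
  proof cases
    case 2
    have "D \<le> (p y - p x) / (y - x)"
    proof (rule tendsto_upperbound[OF lim])
      show "\<forall>\<^sub>F u in at_right x. (p u - p x) / (u - x) \<le> (p y - p x) / (y - x)"
        using eventually_at_right_real[OF 2]
        by eventually_elim (auto intro: convex_on_slope_mono[OF assms(1)])
    qed auto
    then show ?thesis using 2 by (simp add: field_simps)
  next
    case 3
    have "(p x - p y) / (x - y) \<le> D"
    proof (rule tendsto_lowerbound[OF lim])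
      show "\<forall>\<^sub>F u in at_right x. (p x - p y) / (x - y) \<le> (p u - p x) / (u - x)"
        using eventually_at_right_less
        by eventually_elim (auto intro: convex_on_slope_left_le_right[OF assms(1) 3])
    qed auto
    then show ?thesis using 3 by (simp add: field_simps)
  qed auto
qed

section \<open>The maximum modulus of an entire function\<close>

lemma bdd_above_norm_sphere:
  fixes f :: "complex \<Rightarrow> complex"
  assumes "f holomorphic_on UNIV"
  shows "bdd_above ((\<lambda>z. norm (f z)) ` sphere 0 r)"
proof -
  have "continuous_on (sphere 0 r) f"
    using assms holomorphic_on_imp_continuous_on holomorphic_on_subset by blast
  then have "compact ((\<lambda>z. norm (f z)) ` sphere 0 r)"
    by (intro compact_continuous_image continuous_intros) auto
  then show ?thesis
    by (simp add: bounded_imp_bdd_above compact_imp_bounded)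
qed

lemma norm_le_max_modulus:
  assumes "f holomorphic_on UNIV" "norm z \<le> r"
  shows "norm (f z) \<le> max_modulus r f"
proof (rule maximum_modulus_frontier[of f "cball 0 r"])
  show "f holomorphic_on interior (cball 0 r)"
    using assms(1) holomorphic_on_subset by blast
  show "continuous_on (closure (cball 0 r)) f"
    using assms(1) holomorphic_on_imp_continuous_on holomorphic_on_subset by blast
  show "norm (f w) \<le> max_modulus r f" if "w \<in> frontier (cball 0 r)" for w
    unfolding max_modulus_def
    by (rule cSUP_upper[OF _ bdd_above_norm_sphere[OF assms(1)]]) (use that in auto)
qed (use assms in auto)

lemma max_modulus_le:
  assumes "r \<ge> 0" "\<And>z. norm z = r \<Longrightarrow> norm (f z) \<le> B"
  shows "max_modulus r f \<le> B"
  unfolding max_modulus_def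
proof (rule cSUP_least)
  show "sphere (0::complex) r \<noteq> {}"
    using assms(1) by simp
qed (use assms in auto)

lemma transcendental_entire_not_constant_on:
  assumes "transcendental_entire f"
  shows "\<not> f constant_on UNIV"
proof
  assume "f constant_on UNIV"
  then obtain c where "\<forall>z. f z = poly [:c:] z"
    by (auto simp: constant_on_def)
  with assms show False
    unfolding transcendental_entire_def by blast
qed

text \<open>Otherwise \<open>f\<close> would vanish on a disc and hence be constant. Positivity
  makes \<open>ln\<close> of the maximum modulus meaningful.\<close>

lemma max_modulus_pos:
  assumes f: "transcendental_entire f" and "r > 0"
  shows "max_modulus r f > 0"
proof (rule ccontr)
  have hol: "f holomorphic_on UNIV"
    using f by (simp add: transcendental_entire_def)
  assume "\<not> max_modulus r f > 0"
  then have zero: "f z = 0" if "norm z \<le> r" for z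
    using norm_le_max_modulus[OF hol that] by (simp flip: norm_le_zero_iff)
  have "f constant_on UNIV"
    by (rule maximum_modulus_principle[OF hol, of "ball 0 r" 0]) (use zero \<open>r > 0\<close> in auto)
  with transcendental_entire_not_constant_on[OF f] show False ..
qed

text \<open>Liouville's theorem supplies a point where |f| > 1, and by the maximum principle every
  larger circle inherits this bound.\<close>

lemma eventually_log_max_modulus_pos:
  assumes f: "transcendental_entire f"
  shows "\<forall>\<^sub>F t in at_top. log_max_modulus f t > 0"
proof -
  have hol: "f holomorphic_on UNIV"
    using f by (simp add: transcendental_entire_def)
  have "\<not> bounded (range f)"
    using Liouville_theorem[OF hol] transcendental_entire_not_constant_on[OF f] by blast
  then obtain z where z: "norm (f z) > 1"
    by (auto simp: bounded_iff not_le)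
  show ?thesis
    using eventually_gt_at_top[of "norm z"]
  proof eventually_elim
    case (elim t)
    then have "norm z \<le> exp t"
      using exp_ge_add_one_self[of t] by linarith
    from norm_le_max_modulus[OF hol this] z show ?case
      by (simp add: log_max_modulus_def)
  qed
qed

text \<open>
  Multiplication by \<open>z\<^sup>-\<^sup>\<lambda>\<close> is not single-valued on the annulus; its modulus is, and the maximum
  principle is applied to the lift to a strip under the exponential map.
\<close>

lemma three_circles:
  fixes f :: "complex \<Rightarrow> complex" and l C :: real
  assumes hol: "f holomorphic_on UNIV" and r: "0 < r1" "r1 < r2"
    and C: "\<And>z. norm z = r1 \<or> norm z = r2 \<Longrightarrow> norm (f z) * norm z powr (-l) \<le> C"
    and z: "r1 \<le> norm z" "norm z \<le> r2"
  shows "norm (f z) * norm z powr (-l) \<le> C"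
proof -
  define u where "u = (\<lambda>z. norm (f z) * norm z powr (-l))"
  define A where "A = cball (0::complex) r2 - ball 0 r1"
  have "compact A" "A \<noteq> {}"
    unfolding A_def using z by (auto intro: compact_diff)
  moreover have "continuous_on A u"
    unfolding u_def using r
    by (intro continuous_intros continuous_on_subset[OF holomorphic_on_imp_continuous_on[OF hol]])
       (auto simp: A_def)
  ultimately obtain z0 where z0: "z0 \<in> A" and max: "\<And>w. w \<in> A \<Longrightarrow> u w \<le> u z0"
    using continuous_attains_sup by metis
  \<comment> \<open>An interior maximum of \<open>u\<close> lifts to an interior maximum of |h| on
    the strip, which forces the entire function \<open>h\<close> to be constant; so \<open>u\<close>
    takes the same value on the circle of radius \<open>r1\<close>.\<close>
  have "u z0 \<le> C"
  proof (cases "norm z0 = r1 \<or> norm z0 = r2")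
    case True
    then show ?thesis using C by (simp add: u_def)
  next
    case False
    with z0 have n0: "r1 < norm z0" "norm z0 < r2"
      by (auto simp: A_def)
    with r have z0_nz: "z0 \<noteq> 0" by auto
    define h where "h = (\<lambda>w. f (exp w) * exp (- of_real l * w))"
    define U where "U = {w. ln r1 < Re w \<and> Re w < ln r2}"
    have norm_h: "norm (h w) = u (exp w)" for w
      by (simp add: h_def u_def norm_mult powr_def)
    have "h constant_on UNIV"
    proof (rule maximum_modulus_principle)
      have "(f \<circ> exp) holomorphic_on UNIV"
        by (rule holomorphic_on_compose_gen[OF _ hol]) (auto intro: holomorphic_intros)
      then show "h holomorphic_on UNIV"
        unfolding h_def o_def by (intro holomorphic_intros)
      show "open U"
        unfolding U_def
        by (intro open_Collect_conj open_halfspace_Re_gt open_halfspace_Re_lt)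
      show "Ln z0 \<in> U"
        unfolding U_def using n0 r z0_nz by (auto simp: Re_Ln)
      show "norm (h w) \<le> norm (h (Ln z0))" if "w \<in> U" for w
      proof -
        have "r1 < exp (Re w)" "exp (Re w) < r2"
          using that r ln_ge_iff[of r1 "Re w"]
          by (auto simp: U_def not_le) (metis exp_ln exp_less_mono less_trans)+
        then have "exp w \<in> A"
          by (auto simp: A_def)
        then show ?thesis
          using max z0_nz by (simp add: norm_h exp_Ln)
      qed
    qed auto
    then have "norm (h (Ln z0)) = norm (h (of_real (ln r1)))"
      by (metis UNIV_I constant_on_def)
    then have "u z0 = u (of_real r1)"
      using z0_nz r by (simp add: norm_h exp_Ln exp_of_real)
    also have "\<dots> \<le> C"
      using C[of "of_real r1"] r by (simp add: u_def)
    finally show ?thesis .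
  qed
  moreover have "u z \<le> u z0"
    using z by (intro max) (auto simp: A_def)
  ultimately show ?thesis
    by (simp add: u_def)
qed

lemma convex_on_log_max_modulus:
  assumes f: "transcendental_entire f"
  shows "convex_on UNIV (log_max_modulus f)"
proof (rule convex_on_linorderI)
  fix s a b :: real
  assume s: "0 < s" "s < 1" and ab: "a < b"
  have hol: "f holomorphic_on UNIV"
    using f by (simp add: transcendental_entire_def)
  define p where "p = log_max_modulus f"
  have exp_p: "exp (p x) = max_modulus (exp x) f" for x
    using max_modulus_pos[OF f, of "exp x"] by (simp add: p_def log_max_modulus_def)
  \<comment> \<open>\<open>l\<close> is the slope and \<open>C\<close> the intercept of the chord of
    \<open>p\<close> over [a, b], so |f(w)| |w|^(-l) is at most e^C on both boundary
    circles.\<close>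
  define l where "l = (p b - p a) / (b - a)"
  define C where "C = p a - l * a"
  have Cb: "C = p b - l * b"
    using ab by (simp add: C_def l_def field_simps)
  define t where "t = (1 - s) *\<^sub>R a + s *\<^sub>R b"
  have t_eq: "t = a + s * (b - a)"
    by (simp add: t_def algebra_simps)
  have "s * (b - a) < b - a" "0 < s * (b - a)"
    using s ab by simp_all
  then have t: "a < t" "t < b"
    by (simp_all add: t_eq)
  have "max_modulus (exp t) f \<le> exp (C + l * t)"
  proof (rule max_modulus_le)
    fix z :: complex
    assume z: "norm z = exp t"
    have "norm (f z) * norm z powr (-l) \<le> exp C"
    proof (rule three_circles[OF hol, of "exp a" "exp b"])
      fix w :: complex
      assume "norm w = exp a \<or> norm w = exp b"
      then obtain x where x: "norm w = exp x" "C = p x - l * x"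
        using C_def Cb by auto
      have "norm (f w) * norm w powr (-l) \<le> exp (p x) * exp (- l * x)"
        unfolding exp_p using norm_le_max_modulus[OF hol, of w "exp x"] x(1)
        by (simp add: powr_def)
      also have "\<dots> = exp C"
        by (simp add: x(2) flip: exp_add)
      finally show "norm (f w) * norm w powr (-l) \<le> exp C" .
    qed (use z t ab in auto)
    then have "norm (f z) * exp (- l * t) * exp (l * t) \<le> exp C * exp (l * t)"
      by (intro mult_right_mono) (auto simp: z powr_def)
    then show "norm (f z) \<le> exp (C + l * t)"
      by (simp add: exp_add exp_minus field_simps)
  qed auto
  then have "p t \<le> C + l * t"
    by (simp flip: exp_p)
  also have "\<dots> = p a + l * (b - a) * s"
    by (simp add: C_def t_eq algebra_simps)
  also have "l * (b - a) = p b - p a"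
    using ab by (simp add: l_def)
  also have "p a + (p b - p a) * s = (1 - s) * p a + s * p b"
    by (simp add: algebra_simps)
  finally show "log_max_modulus f ((1 - s) *\<^sub>R a + s *\<^sub>R b)
      \<le> (1 - s) * log_max_modulus f a + s * log_max_modulus f b"
    by (simp add: p_def t_def)
qed auto

section \<open>Log-regularity as a growth condition\<close>

text \<open>From \<open>t\<close> to \<open>2 * t\<close> the tangent rises by \<open>D * t\<close>,
  which log-regularity makes at least \<open>1 + c\<close> times the value at
  \<open>t\<close>.\<close>

lemma log_regular_with_doubling:
  assumes f: "transcendental_entire f" and "log_regular_with c f"
  shows "\<forall>\<^sub>F t in at_top. log_max_modulus f (2 * t) \<ge> (2 + c) * log_max_modulus f t"
  using assms(2)[unfolded log_regular_with_def] eventually_log_max_modulus_pos[OF f]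
    eventually_gt_at_top[of 0]
proof eventually_elim
  case (elim t)
  then obtain D where D: "(log_max_modulus f has_real_derivative D) (at_right t)"
    and "D / log_max_modulus f t \<ge> (1 + c) / t" by blast
  with elim have "(1 + c) * log_max_modulus f t \<le> D * t"
    by (simp add: field_simps)
  moreover have "log_max_modulus f t + D * (2 * t - t) \<le> log_max_modulus f (2 * t)"
    by (rule convex_on_right_tangent_le[OF convex_on_log_max_modulus[OF f] D])
  ultimately show ?case
    by (simp add: algebra_simps)
qed

lemma iterate_doubling:
  fixes p :: "real \<Rightarrow> real"
  assumes "T \<ge> 0" "q \<ge> 0" and step: "\<And>t. t \<ge> T \<Longrightarrow> p (2 * t) \<ge> q * p t" and "t \<ge> T"
  shows "p (2 ^ n * t) \<ge> q ^ n * p t"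
proof (induction n)
  case (Suc n)
  \<comment> \<open>Since \<open>T\<close> is nonnegative, so is \<open>t\<close>, and the iterated
    doublings stay in the range of \<open>step\<close>.\<close>
  have "1 * t \<le> 2 ^ n * t"
    using assms by (intro mult_right_mono) auto
  then have "q * p (2 ^ n * t) \<le> p (2 * (2 ^ n * t))"
    using assms by (intro step) auto
  moreover have "q * (q ^ n * p t) \<le> q * p (2 ^ n * t)"
    using Suc assms by (intro mult_left_mono)
  ultimately show ?case
    by (simp add: mult.assoc)
qed auto

text \<open>A converse to doubling: growth makes the value at \<open>t / K\<close> small, so the
  tangent at \<open>t\<close>, which lies below it there, must be steep.\<close>

lemma log_regular_if_growth:
  assumes g: "transcendental_entire g" and K: "1 < K" "K < L"
    and growth: "\<forall>\<^sub>F t in at_top. log_max_modulus g (K * t) \<ge> L * log_max_modulus g t"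
  shows "log_regular g"
proof -
  define p where "p = log_max_modulus g"
  \<comment> \<open>The tangent at \<open>t\<close>, evaluated at \<open>t / K\<close>, yields
    exactly this quotient as lower bound for \<open>D * t / p t\<close>; it exceeds 1 because
    \<open>L > K\<close>.\<close>
  define c where "c = (1 - 1 / L) / (1 - 1 / K) - 1"
  have "1 / L < 1 / K" "1 / K < 1"
    using K by (auto simp: field_simps)
  then have "c > 0"
    by (simp add: c_def field_simps)
  have "filterlim (\<lambda>t. t / K) at_top at_top"
    using K by real_asymp
  then have "\<forall>\<^sub>F t in at_top. p (K * (t / K)) \<ge> L * p (t / K)"
    using growth unfolding p_def by (rule eventually_compose_filterlim[rotated])
  moreover have "\<forall>\<^sub>F t in at_top. p t > 0"
    using eventually_log_max_modulus_pos[OF g] by (simp add: p_def)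
  ultimately have "\<forall>\<^sub>F t in at_top. \<exists>D. (p has_real_derivative D) (at_right t) \<and>
      D / p t \<ge> (1 + c) / t"
    using eventually_gt_at_top[of 0]
  proof eventually_elim
    case (elim t)
    have conv: "convex_on UNIV p"
      unfolding p_def by (rule convex_on_log_max_modulus[OF g])
    then obtain D where D: "(p has_real_derivative D) (at_right t)"
      using convex_on_right_derivative_exists by blast
    have "p t + D * (t / K - t) \<le> p (t / K)"
      by (rule convex_on_right_tangent_le[OF conv D])
    also have "\<dots> \<le> p t / L"
      using elim K by (simp add: field_simps)
    finally have "p t * (1 - 1 / L) \<le> D * t * (1 - 1 / K)"
      by (simp add: algebra_simps)
    then have "p t * (1 + c) \<le> D * t"
      using \<open>1 / K < 1\<close> by (simp add: c_def pos_divide_le_eq)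
    then have "(1 + c) / t \<le> D / p t"
      using elim by (simp add: field_simps)
    with D show ?case by blast
  qed
  with \<open>c > 0\<close> show ?thesis
    unfolding log_regular_def log_regular_with_def p_def by blast
qed

text \<open>With r = e^t, raising the radius to the power \<open>a\<close> becomes the dilation of
  \<open>t\<close> by \<open>a\<close>.\<close>

lemma log_max_modulus_le_if_max_modulus_le:
  assumes f: "transcendental_entire f"
    and "max_modulus (exp t) f \<le> max_modulus (exp t powr a) g"
  shows "log_max_modulus f t \<le> log_max_modulus g (a * t)"
  using assms(2) max_modulus_pos[OF f, of "exp t"]
  by (simp add: log_max_modulus_def powr_def ln_mono)

theorem theorem2p4:
  fixes f g :: "complex \<Rightarrow> complex" and a1 a2 R0 :: real
  assumes "transcendental_entire f" and "transcendental_entire g"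
    and "log_regular f"
    and "a1 \<ge> 1" and "a2 \<ge> 1" and "R0 > 0"
    and "\<And>r. r \<ge> R0 \<Longrightarrow> max_modulus (r powr a1) g \<ge> max_modulus r f"
    and "\<And>r. r \<ge> R0 \<Longrightarrow> max_modulus (r powr a2) f \<ge> max_modulus r g"
  shows "log_regular g"
proof -
  define p where "p = log_max_modulus f"
  define q where "q = log_max_modulus g"
  obtain c where c: "c > 0" "log_regular_with c f"
    using assms(3) by (auto simp: log_regular_def)
  obtain T where T: "\<And>t. t \<ge> T \<Longrightarrow> p (2 * t) \<ge> (2 + c) * p t"
    using log_regular_with_doubling[OF assms(1) c(2)]
    by (auto simp: eventually_at_top_linorder p_def)
  have R0: "exp t \<ge> R0" if "t \<ge> ln R0" for t
    using that \<open>R0 > 0\<close> by (metis exp_le_cancel_iff exp_ln)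
  have pq: "p t \<le> q (a1 * t)" and qp: "q t \<le> p (a2 * t)" if "t \<ge> ln R0" for t
    unfolding p_def q_def using assms(1,2,7,8) R0[OF that]
    by (auto intro!: log_max_modulus_le_if_max_modulus_le)
  \<comment> \<open>This choice makes the growth factor \<open>(2 + c) ^ n\<close> exceed the total
    dilation \<open>2 ^ n * (a1 * a2)\<close>.\<close>
  obtain n where n: "((2 + c) / 2) ^ n > a1 * a2"
    using real_arch_pow[of "(2 + c) / 2"] c by auto
  define K where "K = 2 ^ n * (a1 * a2)"
  have a: "a1 * a2 \<ge> 1"
    using mult_mono[of 1 a1 1 a2] assms(4,5) by simp
  \<comment> \<open>At least one doubling occurs, so \<open>K > 1\<close> even when
    \<open>a1 = a2 = 1\<close>.\<close>
  with n have "n \<noteq> 0"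
    by (intro notI) simp
  then have "(2::real) ^ n > 1"
    by simp
  with a have "K > 1"
    unfolding K_def by (meson less_1_mult less_le_trans mult_le_cancel_left1 not_less order_less_imp_le)
  moreover have "K < (2 + c) ^ n"
    using n by (simp add: K_def power_divide field_simps)
  moreover have "\<forall>\<^sub>F t in at_top. q (K * t) \<ge> (2 + c) ^ n * q t"
    using eventually_ge_at_top[of "max 0 (max T (ln R0))"]
  proof eventually_elim
    case (elim t)
    have "1 * t \<le> a2 * t"
      using elim assms(5) by (intro mult_right_mono) auto
    moreover from this have "1 * (a2 * t) \<le> 2 ^ n * (a2 * t)"
      using elim by (intro mult_right_mono) auto
    ultimately have t: "a2 * t \<ge> max 0 T" "2 ^ n * (a2 * t) \<ge> ln R0"
      using elim by auto
    \<comment> \<open>Pass from \<open>q\<close> to \<open>p\<close> at the cost of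
      \<open>a2\<close>, double \<open>n\<close> times, and return to \<open>q\<close> at the cost
      of \<open>a1\<close>.\<close>
    have "(2 + c) ^ n * q t \<le> (2 + c) ^ n * p (a2 * t)"
      using c elim by (intro mult_left_mono qp) auto
    also have "\<dots> \<le> p (2 ^ n * (a2 * t))"
      using c T t by (intro iterate_doubling[of "max 0 T"]) auto
    also have "\<dots> \<le> q (a1 * (2 ^ n * (a2 * t)))"
      by (rule pq) (fact t)
    also have "a1 * (2 ^ n * (a2 * t)) = K * t"
      by (simp add: K_def algebra_simps)
    finally show ?case .
  qed
  ultimately show ?thesis
    unfolding q_def by (intro log_regular_if_growth[OF assms(2)])
qed

end
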